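(* Let $k$ and $t$ be positive integers and let $(K_t,w)$ be a bipartite signed edge-weighted complete graph on $t$ vertices satisfying $1\le |w(e)|\le k$ for every edge $e$. Then $(K_t,w)$ is $2k$-wide if and only if each of its triangles (with the weights inherited from $w$) is $2k$-wide.
   Context: A signed graph $(G,\sigma)$ is a graph $G$ with a signature $\sigma:E(G)\to\{+,-\}$. The sign of a cycle is the product of the signs of its edges; a cycle is negative (unbalanced) if its sign is $-$. The unbalanced girth of a signed graph is the length of a shortest negative cycle. A signed edge-weighted graph $(H,w)$ is a graph $H$ with $w:E(H)\to\mathbb{Z}\setminus\{0\}$. It is bipartite if there is a partition $\{X,Y\}$ of $V(H)$ such that every edge with one end in $X$ and one in $Y$ has odd weight and every edge with both ends in $X$ or both ends in $Y$ has even weight. Given a signed edge-weighted graph $(H,w)$ with $1\le |w(e)|\le k$ for every edge, the signed graph $\overline{\overline{(H,w)}}_{-2k}$ is obtained by replacing each edge $e=xy$ by two internally disjoint $x$–$y$ paths (with new internal vertices), one of length $|w(e)|$ and one of length $2k-|w(e)|$, signed so that the path of length $|w(e)|$ has sign equal to the sign of $w(e)$ and the other path has the opposite sign (so together they form a negative $2k$-cycle). $(H,w)$ is called $2k$-wide if $\overline{\overline{(H,w)}}_{-2k}$ has unbalanced girth equal to $2k$. Subgraphs carry the restricted weights.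
   Formalization: For t = 1 the graph has no edges, hence no negative cycle, so its unbalanced girth is undefined (or infinite) and the equivalence fails as written; an edgeless weighted graph is here counted as 2k-wide. For t ≥ 2 and for all triangles the definition is unchanged. *)

theory Defs
  imports Main "HOL-Library.Extended_Nat"
begin

text \<open>Signed multigraphs. Parallel edges have to be allowed: for \<open>k = 1\<close> the
  two paths replacing an edge are two parallel edges of opposite sign.\<close>

record ('v, 'e) signed_graph =
  sverts :: "'v set"
  sedges :: "'e set"
  ends :: "'e \<Rightarrow> 'v set"
  sign :: "'e \<Rightarrow> int"  \<comment> \<open>with values \<open>1\<close> and \<open>-1\<close>\<close>

text \<open>Edge \<open>es ! i\<close> joins \<open>vs ! i\<close> to its cyclic successor. Requiring the edges to be
  distinct matters only for length 2, where it demands two parallel edges.\<close>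

definition is_cycle :: "('v, 'e) signed_graph \<Rightarrow> 'v list \<Rightarrow> 'e list \<Rightarrow> bool" where
  "is_cycle G vs es \<longleftrightarrow>
     vs \<noteq> [] \<and> length es = length vs \<and>
     distinct vs \<and> distinct es \<and> set vs \<subseteq> sverts G \<and> set es \<subseteq> sedges G \<and>
     (\<forall>i < length vs. ends G (es ! i) = {vs ! i, vs ! (Suc i mod length vs)})"

definition cycle_sign :: "('v, 'e) signed_graph \<Rightarrow> 'e list \<Rightarrow> int" where
  "cycle_sign G es = prod_list (map (sign G) es)"

definition is_negative_cycle :: "('v, 'e) signed_graph \<Rightarrow> 'v list \<Rightarrow> 'e list \<Rightarrow> bool" where
  "is_negative_cycle G vs es \<longleftrightarrow> is_cycle G vs es \<and> cycle_sign G es = -1"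

text \<open>The value is \<open>\<infinity>\<close> if there is no negative cycle.\<close>

definition unbalanced_girth :: "('v, 'e) signed_graph \<Rightarrow> enat" where
  "unbalanced_girth G = Inf {enat (length es) | vs es. is_negative_cycle G vs es}"

record 'v sgraph =
  verts :: "'v set"
  edges :: "'v set set"

definition simple_graph :: "'v sgraph \<Rightarrow> bool" where
  "simple_graph H \<longleftrightarrow> finite (verts H) \<and> (\<forall>e \<in> edges H. e \<subseteq> verts H \<and> card e = 2)"

definition complete_graph :: "nat \<Rightarrow> 'v sgraph \<Rightarrow> bool" where
  "complete_graph t H \<longleftrightarrow>
     finite (verts H) \<and> card (verts H) = t \<and> edges H = {e. e \<subseteq> verts H \<and> card e = 2}"

definition subgraph :: "'v sgraph \<Rightarrow> 'v sgraph \<Rightarrow> bool" where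
  "subgraph T H \<longleftrightarrow> simple_graph T \<and> verts T \<subseteq> verts H \<and> edges T \<subseteq> edges H"

definition triangle_of :: "'v sgraph \<Rightarrow> 'v sgraph \<Rightarrow> bool" where
  "triangle_of T H \<longleftrightarrow> subgraph T H \<and> complete_graph 3 T"

text \<open>A weighted graph is a graph \<open>H\<close> together with \<open>w :: 'v set \<Rightarrow> int\<close>, of which only
  the values on \<open>edges H\<close> are relevant; so a subgraph with inherited weights carries the
  same \<open>w\<close>.\<close>

definition edge_weighting :: "'v sgraph \<Rightarrow> ('v set \<Rightarrow> int) \<Rightarrow> bool" where
  "edge_weighting H w \<longleftrightarrow> (\<forall>e \<in> edges H. w e \<noteq> 0)"

text \<open>As usual for bipartitions, one of the two parts may be empty.\<close>

definition bipartite_weighting :: "'v sgraph \<Rightarrow> ('v set \<Rightarrow> int) \<Rightarrow> bool" where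
  "bipartite_weighting H w \<longleftrightarrow>
     (\<exists>X Y. X \<union> Y = verts H \<and> X \<inter> Y = {} \<and>
        (\<forall>x y. {x, y} \<in> edges H \<longrightarrow> x \<in> X \<and> y \<in> Y \<longrightarrow> odd (w {x, y})) \<and>
        (\<forall>x y. {x, y} \<in> edges H \<longrightarrow> (x \<in> X \<and> y \<in> X) \<or> (x \<in> Y \<and> y \<in> Y) \<longrightarrow> even (w {x, y})))"

text \<open>Replacement of every edge \<open>e\<close> by two paths. The path with index \<open>(e, True)\<close> has
  length \<open>\<bar>w e\<bar>\<close>, the one with index \<open>(e, False)\<close> has length \<open>2k - \<bar>w e\<bar>\<close> (no truncation
  occurs when \<open>\<bar>w e\<bar> \<le> k\<close>).  Both run from \<open>tail e\<close> to \<open>head e\<close>, an arbitrary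
  orientation of \<open>e\<close>, which is needed only to number the inner vertices.\<close>

datatype 'v dvertex = Orig 'v | Inner "'v set" bool nat

definition tail :: "'v set \<Rightarrow> 'v" where
  "tail e = (SOME x. x \<in> e)"

definition head :: "'v set \<Rightarrow> 'v" where
  "head e = (SOME y. y \<in> e - {tail e})"

definition path_length :: "nat \<Rightarrow> ('v set \<Rightarrow> int) \<Rightarrow> 'v set \<Rightarrow> bool \<Rightarrow> nat" where
  "path_length k w e b = (if b then nat \<bar>w e\<bar> else 2 * k - nat \<bar>w e\<bar>)"

definition path_sign :: "('v set \<Rightarrow> int) \<Rightarrow> 'v set \<Rightarrow> bool \<Rightarrow> int" where
  "path_sign w e b = (if b then sgn (w e) else - sgn (w e))"

definition path_vertex :: "nat \<Rightarrow> ('v set \<Rightarrow> int) \<Rightarrow> 'v set \<Rightarrow> bool \<Rightarrow> nat \<Rightarrow> 'v dvertex" where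
  "path_vertex k w e b i =
     (if i = 0 then Orig (tail e)
      else if i = path_length k w e b then Orig (head e)
      else Inner e b i)"

text \<open>The \<open>i\<close>-th edge of path \<open>(e, b)\<close> is \<open>(e, b, i)\<close>. Only the sign of a whole path is
  prescribed; it is put on the edge with \<open>i = 0\<close>. Every cycle uses a replacing path
  entirely or not at all, so the distribution of signs along a path does not affect
  the sign of any cycle.\<close>

definition double_path_graph ::
    "nat \<Rightarrow> 'v sgraph \<Rightarrow> ('v set \<Rightarrow> int) \<Rightarrow> ('v dvertex, 'v set \<times> bool \<times> nat) signed_graph" where
  "double_path_graph k H w =
     \<lparr> sverts = Orig ` verts H \<union>
                {Inner e b i | e b i. e \<in> edges H \<and> 0 < i \<and> i < path_length k w e b},
       sedges = {(e, b, i) | e b i. e \<in> edges H \<and> i < path_length k w e b},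
       ends = (\<lambda>(e, b, i). {path_vertex k w e b i, path_vertex k w e b (Suc i)}),
       sign = (\<lambda>(e, b, i). if i = 0 then path_sign w e b else 1) \<rparr>"

lemma prod_sign_path:
  assumes "0 < path_length k w e b"
  shows "(\<Prod>i < path_length k w e b. sign (double_path_graph k H w) (e, b, i)) = path_sign w e b"
  using assms by (simp add: double_path_graph_def prod.delta)

text \<open>A graph without edges has no negative cycle after replacement, hence no
  shortest one; by convention it counts as \<open>2k\<close>-wide. As soon as there is an edge,
  being \<open>2k\<close>-wide means exactly that the unbalanced girth is \<open>2k\<close>.\<close>

definition two_k_wide :: "nat \<Rightarrow> 'v sgraph \<Rightarrow> ('v set \<Rightarrow> int) \<Rightarrow> bool" where
  "two_k_wide k H w \<longleftrightarrow>
     edges H = {} \<or> unbalanced_girth (double_path_graph k H w) = enat (2 * k)"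

end

theory Submission
  imports Defs
begin

text \<open>Let \<open>p e\<close> be the length of the positive one of the two paths replacing \<open>e\<close>, so that the
  negative one has length \<open>2k - p e\<close>. A triangle is \<open>2k\<close>-wide iff \<open>p\<close> satisfies the triangle
  inequality on it and its perimeter with respect to \<open>p\<close> is at most \<open>4k\<close>. If this holds for all
  triangles, fix a vertex \<open>x\<close> and set \<open>h y = k - p {x, y}\<close>, \<open>h x = k\<close>. The triangle conditions say
  precisely that \<open>h\<close> extends to the subdivision as a potential \<open>F\<close> with
  \<open>\<bar>F u - s * F v\<bar> \<le> 1\<close> for each edge \<open>uv\<close> of sign \<open>s\<close>. Going once around a negative cycle
  through \<open>x\<close> turns \<open>F x = k\<close> into \<open>-k\<close>, which takes at least \<open>2k\<close> steps.\<close>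

section \<open>Cycles and potentials in signed graphs\<close>

text \<open>The closing vertex \<open>c\<close> is kept out of \<open>vs\<close>, so that chains can
  be concatenated without repeating a joint and a cycle is a chain closing at its own head.\<close>

definition chain :: "('v, 'e) signed_graph \<Rightarrow> 'v list \<Rightarrow> 'e list \<Rightarrow> 'v \<Rightarrow> bool" where
  "chain G vs es c \<longleftrightarrow> vs \<noteq> [] \<and> length es = length vs \<and>
     (\<forall>i < length vs. ends G (es ! i) = {vs ! i, (vs @ [c]) ! Suc i})"

lemma chain_append:
  assumes "chain G vs es (hd vs')" "chain G vs' es' c"
  shows "chain G (vs @ vs') (es @ es') c"
  unfolding chain_def
proof (intro conjI allI impI)
  show "vs @ vs' \<noteq> []" "length (es @ es') = length (vs @ vs')"
    using assms by (auto simp: chain_def)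
  have len: "length es = length vs" "vs' \<noteq> []" using assms by (auto simp: chain_def)
  fix i assume i: "i < length (vs @ vs')"
  show "ends G ((es @ es') ! i) = {(vs @ vs') ! i, ((vs @ vs') @ [c]) ! Suc i}"
  proof (cases "i < length vs")
    case True
    have "(vs @ [hd vs']) ! Suc i = ((vs @ vs') @ [c]) ! Suc i"
      using True len(2) by (cases "Suc i < length vs") (auto simp: nth_append hd_conv_nth not_less_eq less_Suc_eq)
    then show ?thesis using True assms(1) len by (simp add: chain_def nth_append)
  next
    case False
    then have "Suc i - length vs = Suc (i - length vs)" by simp
    moreover have "((vs @ vs') @ [c]) ! Suc i = (vs' @ [c]) ! (Suc i - length vs)"
      unfolding append_assoc using False by (subst nth_append) simp
    ultimately show ?thesis using False i assms(2) len by (simp add: chain_def nth_append)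
  qed
qed

lemma is_cycle_chain:
  assumes "chain G vs es (hd vs)" "distinct vs" "distinct es"
    "set vs \<subseteq> sverts G" "set es \<subseteq> sedges G"
  shows "is_cycle G vs es"
proof -
  have "(vs @ [hd vs]) ! Suc i = vs ! (Suc i mod length vs)" if "i < length vs" for i
  proof (cases "Suc i = length vs")
    case True
    then have "vs \<noteq> []" by auto
    with True show ?thesis by (simp add: nth_append hd_conv_nth)
  next
    case False with that show ?thesis by (simp add: nth_append)
  qed
  then show ?thesis using assms by (auto simp: is_cycle_def chain_def)
qed

lemma is_negative_cycle_rotate1:
  assumes "is_negative_cycle G vs es"
  shows "is_negative_cycle G (rotate1 vs) (rotate1 es)"
proof -
  have "prod_list (map (sign G) (rotate1 es)) = prod_list (map (sign G) es)"
    by (cases es) (auto simp: mult.commute)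
  moreover have "ends G (rotate1 es ! i) = {rotate1 vs ! i, rotate1 vs ! (Suc i mod length vs)}"
    if i: "i < length vs" for i
  proof -
    have "Suc i mod length vs < length vs" using i by (intro mod_less_divisor) linarith
    then show ?thesis
      using assms i by (simp add: is_negative_cycle_def is_cycle_def nth_rotate1)
  qed
  ultimately show ?thesis
    using assms by (simp add: is_negative_cycle_def is_cycle_def cycle_sign_def)
qed

lemma is_negative_cycle_rotate:
  assumes "is_negative_cycle G vs es"
  shows "is_negative_cycle G (rotate n vs) (rotate n es)"
  by (induction n) (simp_all add: assms is_negative_cycle_rotate1)

text \<open>Read from \<open>u\<close>, the value of \<open>F\<close>, corrected by the sign of the
  edges passed so far, changes by at most 1 per edge. A full turn returns to \<open>u\<close> with
  sign -1, so the total change is \<open>2 * F u\<close>.\<close>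

lemma negative_cycle_length_ge:
  fixes F :: "'v \<Rightarrow> int"
  assumes cyc: "is_negative_cycle G vs es"
    and sgn: "\<And>e. e \<in> sedges G \<Longrightarrow> \<bar>sign G e\<bar> = 1"
    and F: "\<And>e u v. e \<in> sedges G \<Longrightarrow> ends G e = {u, v} \<Longrightarrow> \<bar>F u - sign G e * F v\<bar> \<le> 1"
    and u: "u \<in> set vs"
  shows "2 * \<bar>F u\<bar> \<le> int (length es)"
proof -
  obtain m where m: "m < length vs" "vs ! m = u" using u by (auto simp: in_set_conv_nth)
  define ws fs where "ws = rotate m vs" and "fs = rotate m es"
  have cyc': "is_negative_cycle G ws fs"
    unfolding ws_def fs_def by (rule is_negative_cycle_rotate[OF cyc])
  have ws0: "ws ! 0 = u"
    using m nth_rotate[of 0 vs m] by (cases vs) (auto simp: ws_def)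
  define n where "n = length ws"
  have n: "n > 0" "length fs = n" "length es = n"
    using cyc' by (auto simp: n_def is_negative_cycle_def is_cycle_def fs_def)
  define S where "S j = prod_list (map (sign G) (take j fs))" for j
  have E: "fs ! j \<in> sedges G" "ends G (fs ! j) = {ws ! j, ws ! (Suc j mod n)}" if "j < n" for j
    using cyc' that by (auto simp: is_negative_cycle_def is_cycle_def n_def)
  \<comment> \<open>The \<open>mod\<close> matters at \<open>j = n\<close> only, where the walk is
    back at \<open>ws ! 0 = u\<close>.\<close>
  have *: "\<bar>F u - S j * F (ws ! (j mod n))\<bar> \<le> int j \<and> \<bar>S j\<bar> = 1" if "j \<le> n" for j
    using that
  proof (induction j)
    case 0
    then show ?case by (simp add: S_def ws0)
  next
    case (Suc j)
    let ?s = "sign G (fs ! j)"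
    have j: "j < n" using Suc by simp
    have S: "S (Suc j) = S j * ?s" using j n by (simp add: S_def take_Suc_conv_app_nth)
    have "\<bar>S j * (F (ws ! j) - ?s * F (ws ! (Suc j mod n)))\<bar> \<le> 1"
      using Suc F[OF E[OF j]] by (simp add: abs_mult)
    moreover have "F u - S (Suc j) * F (ws ! (Suc j mod n)) =
        (F u - S j * F (ws ! j)) + S j * (F (ws ! j) - ?s * F (ws ! (Suc j mod n)))"
      by (simp add: S algebra_simps)
    ultimately have "\<bar>F u - S (Suc j) * F (ws ! (Suc j mod n))\<bar> \<le> int (Suc j)"
      using Suc j by simp linarith
    then show ?case using Suc j sgn[OF E(1)[OF j]] by (simp add: S abs_mult)
  qed
  have "S n = -1" using cyc' n by (simp add: S_def is_negative_cycle_def cycle_sign_def)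
  with *[of n] ws0 n show ?thesis by simp
qed

section \<open>Paths in the subdivision\<close>

text \<open>The orientation comes from a choice operator, so nothing tells which end is the tail;
  both cases have to be carried along.\<close>

lemma tail_head_cases:
  assumes "e = {a, c}" "a \<noteq> c"
  obtains "tail e = a" "head e = c" | "tail e = c" "head e = a"
proof -
  have "tail e \<in> e" unfolding tail_def by (rule someI_ex) (use assms in auto)
  moreover have "head e \<in> e - {tail e}"
  proof -
    have "a \<in> e - {tail e} \<or> c \<in> e - {tail e}" using assms by auto
    then have "\<exists>y. y \<in> e - {tail e}" by blast
    then show ?thesis unfolding head_def by (rule someI_ex)
  qed
  ultimately show ?thesis using that assms by auto
qed

lemma edge_tail_head:
  assumes "card e = 2"
  shows "e = {tail e, head e}" "tail e \<noteq> head e"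
proof -
  obtain a c where ac: "e = {a, c}" "a \<noteq> c" using assms by (auto simp: card_2_iff)
  show "e = {tail e, head e}" "tail e \<noteq> head e"
    by (rule tail_head_cases[OF ac]; use ac in auto)+
qed

text \<open>Lets a replacing path be traversed from either end, whatever its orientation. Among the
  vertices listed only the start is original, and all others carry the tag \<open>(e, b)\<close>,
  which makes the later disjointness checks immediate.\<close>

lemma path_chain:
  assumes e: "e \<in> edges H" "e = {a, c}" "a \<noteq> c" "e \<subseteq> verts H"
    and L: "0 < path_length k w e b"
    and G: "G = double_path_graph k H w"
  obtains vs es where "chain G vs es (Orig c)" "hd vs = Orig a"
    "length es = path_length k w e b" "distinct vs" "distinct es"
    "\<forall>v \<in> set vs. v = Orig a \<or> (\<exists>i. v = Inner e b i)" "\<forall>d \<in> set es. \<exists>i. d = (e, b, i)"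
    "set vs \<subseteq> sverts G" "set es \<subseteq> sedges G"
    "cycle_sign G es = path_sign w e b"
proof -
  define L where "L = path_length k w e b"
  have L0: "L > 0" using L L_def by simp
  define P where "P = path_vertex k w e b"
  have P: "P 0 = Orig (tail e)" "P L = Orig (head e)" "\<And>i. 0 < i \<Longrightarrow> i < L \<Longrightarrow> P i = Inner e b i"
    using L0 by (auto simp: P_def path_vertex_def L_def)
  have th: "tail e \<noteq> head e" using tail_head_cases[OF e(2,3)] e(3) by metis
  have inj: "inj_on P {0..<Suc L}"
    unfolding P_def path_vertex_def inj_on_def L_def[symmetric] using th
    by (simp split: if_splits)
  have ends: "ends G (e, b, i) = {P i, P (Suc i)}" for i
    by (simp add: G double_path_graph_def P_def)
  have "tail e \<in> verts H" "head e \<in> verts H"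
    by (rule tail_head_cases[OF e(2,3)]; use e(2,4) in simp)+
  then have P_verts: "P i \<in> sverts G" if "i \<le> L" for i
    using that e(1) by (auto simp: P_def path_vertex_def L_def G double_path_graph_def)
  have sub_edges: "(e, b, i) \<in> sedges G" if "i < L" for i
    using that e(1) by (simp add: G L_def double_path_graph_def)
  have sgnG: "prod_list (map (sign G) (map (\<lambda>i. (e, b, i)) [0..<L])) = path_sign w e b"
    using prod_sign_path[OF L, of H]
    by (simp add: comp_def G L_def prod.distinct_set_conv_list[symmetric] atLeast0LessThan)
  from tail_head_cases[OF e(2,3)] show ?thesis
  proof cases
    case 1
    let ?vs = "map P [0..<L]" and ?es = "map (\<lambda>i. (e, b, i)) [0..<L]"
    show ?thesis
    proof (rule that[of ?vs ?es])
      have "?vs @ [Orig c] = map P [0..<Suc L]" using P 1 by simp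
      then show "chain G ?vs ?es (Orig c)"
        unfolding chain_def using L0 by (auto simp: ends simp del: upt_Suc)
      show "hd ?vs = Orig a" using L0 P 1 by (simp add: hd_map)
      show "distinct ?vs" using inj by (auto simp: distinct_map intro: inj_on_subset)
      show "\<forall>v \<in> set ?vs. v = Orig a \<or> (\<exists>i. v = Inner e b i)"
        using P 1 by (auto simp: P_def path_vertex_def L_def)
      show "set ?vs \<subseteq> sverts G" using P_verts by auto
      show "cycle_sign G ?es = path_sign w e b" using sgnG by (simp add: cycle_sign_def)
    qed (auto simp: L_def[symmetric] sub_edges distinct_map inj_on_def)
  next
    case 2
    \<comment> \<open>Backwards the vertices are \<open>P L, ..., P 1\<close>, since
      \<open>P 0\<close> is now the closing vertex \<open>Orig c\<close>, while the edges are
      numbered \<open>L - 1, ..., 0\<close>.\<close>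
    let ?vs = "map P (rev [1..<Suc L])" and ?es = "map (\<lambda>i. (e, b, i)) (rev [0..<L])"
    show ?thesis
    proof (rule that[of ?vs ?es])
      have "[0..<Suc L] = 0 # [1..<Suc L]" by (metis upt_conv_Cons zero_less_Suc One_nat_def)
      then have eq: "?vs @ [Orig c] = map P (rev [0..<Suc L])" using P 2 by simp
      have "?vs ! i = P (L - i)" "(?vs @ [Orig c]) ! Suc i = P (L - Suc i)" if "i < L" for i
        unfolding eq using that by (auto simp: rev_nth Suc_diff_Suc simp del: upt_Suc)
      moreover have "ends G (?es ! i) = {P (L - Suc i), P (L - i)}" if "i < L" for i
        using that by (simp add: rev_nth ends Suc_diff_Suc)
      ultimately show "chain G ?vs ?es (Orig c)"
        unfolding chain_def using L0
        by (auto simp: insert_commute simp del: upt_Suc)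
      show "hd ?vs = Orig a" using L0 P 2 by simp
      show "distinct ?vs"
        unfolding distinct_map
        by (auto simp del: upt_Suc intro: inj_on_subset[OF inj])
      show "\<forall>v \<in> set ?vs. v = Orig a \<or> (\<exists>i. v = Inner e b i)"
        using P 2 by (auto simp: P_def path_vertex_def L_def)
      show "set ?vs \<subseteq> sverts G" using P_verts by auto
      show "cycle_sign G ?es = path_sign w e b"
        using sgnG by (simp add: cycle_sign_def rev_map[symmetric] prod_list.rev)
    qed (auto simp: L_def[symmetric] sub_edges distinct_map inj_on_def)
  qed
qed

section \<open>Negative cycles over an edge and over a triangle\<close>

lemma disjoint_path_vertices:
  assumes "\<forall>v \<in> A. v = Orig a \<or> (\<exists>i. v = Inner e b i)"
    "\<forall>v \<in> B. v = Orig c \<or> (\<exists>i. v = Inner f b' i)" "a \<noteq> c" "(e, b) \<noteq> (f, b')"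
  shows "A \<inter> B = {}"
proof -
  have False if "v \<in> A" "v \<in> B" for v
    using bspec[OF assms(1) that(1)] bspec[OF assms(2) that(2)] assms(3,4) by auto
  then show ?thesis by blast
qed

lemma disjoint_path_edges:
  assumes "\<forall>d \<in> A. \<exists>i. d = (e, b, i)" "\<forall>d \<in> B. \<exists>i. d = (f, b', i)" "(e, b) \<noteq> (f, b')"
  shows "A \<inter> B = {}"
proof -
  have False if "d \<in> A" "d \<in> B" for d
    using bspec[OF assms(1) that(1)] bspec[OF assms(2) that(2)] assms(3) by auto
  then show ?thesis by blast
qed

text \<open>The two paths replacing \<open>e\<close> are run out and back. Their signs are opposite
  and their lengths add up to \<open>2 * k\<close>; this gives the upper bound on the unbalanced
  girth.\<close>

lemma edge_negative_cycle:
  assumes e: "e \<in> edges H" "card e = 2" "e \<subseteq> verts H"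
    and w: "1 \<le> \<bar>w e\<bar>" "\<bar>w e\<bar> \<le> int k" "0 < k"
  obtains vs es where "is_negative_cycle (double_path_graph k H w) vs es" "length es = 2 * k"
proof -
  let ?G = "double_path_graph k H w"
  obtain a c where ac: "e = {a, c}" "a \<noteq> c" using e(2) by (auto simp: card_2_iff)
  have L: "path_length k w e True > 0" "path_length k w e False > 0"
    "path_length k w e True + path_length k w e False = 2 * k"
    using w by (auto simp: path_length_def)
  obtain vs1 es1 where 1: "chain ?G vs1 es1 (Orig c)" "hd vs1 = Orig a"
    "length es1 = path_length k w e True" "distinct vs1" "distinct es1"
    "\<forall>v \<in> set vs1. v = Orig a \<or> (\<exists>i. v = Inner e True i)" "\<forall>d \<in> set es1. \<exists>i. d = (e, True, i)"
    "set vs1 \<subseteq> sverts ?G" "set es1 \<subseteq> sedges ?G"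
    "cycle_sign ?G es1 = path_sign w e True"
    using path_chain[OF e(1) ac e(3) L(1) refl] by blast
  have ca: "e = {c, a}" "c \<noteq> a" using ac by auto
  obtain vs2 es2 where 2: "chain ?G vs2 es2 (Orig a)" "hd vs2 = Orig c"
    "length es2 = path_length k w e False" "distinct vs2" "distinct es2"
    "\<forall>v \<in> set vs2. v = Orig c \<or> (\<exists>i. v = Inner e False i)" "\<forall>d \<in> set es2. \<exists>i. d = (e, False, i)"
    "set vs2 \<subseteq> sverts ?G" "set es2 \<subseteq> sedges ?G"
    "cycle_sign ?G es2 = path_sign w e False"
    using path_chain[OF e(1) ca e(3) L(2) refl] by blast
  have ne: "vs1 \<noteq> []" "vs2 \<noteq> []" using 1 2 by (auto simp: chain_def)
  have "is_cycle ?G (vs1 @ vs2) (es1 @ es2)"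
  proof (rule is_cycle_chain)
    show "chain ?G (vs1 @ vs2) (es1 @ es2) (hd (vs1 @ vs2))"
      using 1 2 ne by (intro chain_append) simp_all
    show "distinct (vs1 @ vs2)" using 1(4) 2(4) disjoint_path_vertices[OF 1(6) 2(6) ac(2)] by simp
    show "distinct (es1 @ es2)" using 1(5) 2(5) disjoint_path_edges[OF 1(7) 2(7)] by simp
    show "set (vs1 @ vs2) \<subseteq> sverts ?G" using 1(8) 2(8) by simp
    show "set (es1 @ es2) \<subseteq> sedges ?G" using 1(9) 2(9) by simp
  qed
  moreover have "cycle_sign ?G (es1 @ es2) = -1"
    using 1(10) 2(10) w(1) by (auto simp: cycle_sign_def path_sign_def sgn_if)
  ultimately show ?thesis
    using that[of "vs1 @ vs2" "es1 @ es2"] 1(3) 2(3) L(3) by (simp add: is_negative_cycle_def)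
qed

text \<open>One path is chosen over each side, freely apart from the product of the signs. The three
  chains start at different corners and carry different edges as tags, hence are disjoint.\<close>

lemma triangle_negative_cycle:
  assumes xyz: "x \<noteq> y" "y \<noteq> z" "z \<noteq> x" "{x, y, z} \<subseteq> verts H"
    and e: "e = {x, y}" "f = {y, z}" "g = {z, x}" "{e, f, g} \<subseteq> edges H"
    and L: "0 < path_length k w e b1" "0 < path_length k w f b2" "0 < path_length k w g b3"
    and s: "path_sign w e b1 * path_sign w f b2 * path_sign w g b3 = -1"
  obtains vs es where "is_negative_cycle (double_path_graph k H w) vs es"
    "length es = path_length k w e b1 + path_length k w f b2 + path_length k w g b3"
proof -
  let ?G = "double_path_graph k H w"
  have efg: "e \<in> edges H" "f \<in> edges H" "g \<in> edges H" "e \<noteq> f" "f \<noteq> g" "g \<noteq> e"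
    using e xyz by (auto simp: doubleton_eq_iff)
  have sub: "e \<subseteq> verts H" "f \<subseteq> verts H" "g \<subseteq> verts H" using e xyz(4) by auto
  obtain vs1 es1 where 1: "chain ?G vs1 es1 (Orig y)" "hd vs1 = Orig x"
    "length es1 = path_length k w e b1" "distinct vs1" "distinct es1"
    "\<forall>v \<in> set vs1. v = Orig x \<or> (\<exists>i. v = Inner e b1 i)" "\<forall>d \<in> set es1. \<exists>i. d = (e, b1, i)"
    "set vs1 \<subseteq> sverts ?G" "set es1 \<subseteq> sedges ?G"
    "cycle_sign ?G es1 = path_sign w e b1"
    using path_chain[OF efg(1) e(1) xyz(1) sub(1) L(1) refl] by blast
  obtain vs2 es2 where 2: "chain ?G vs2 es2 (Orig z)" "hd vs2 = Orig y"
    "length es2 = path_length k w f b2" "distinct vs2" "distinct es2"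
    "\<forall>v \<in> set vs2. v = Orig y \<or> (\<exists>i. v = Inner f b2 i)" "\<forall>d \<in> set es2. \<exists>i. d = (f, b2, i)"
    "set vs2 \<subseteq> sverts ?G" "set es2 \<subseteq> sedges ?G"
    "cycle_sign ?G es2 = path_sign w f b2"
    using path_chain[OF efg(2) e(2) xyz(2) sub(2) L(2) refl] by blast
  obtain vs3 es3 where 3: "chain ?G vs3 es3 (Orig x)" "hd vs3 = Orig z"
    "length es3 = path_length k w g b3" "distinct vs3" "distinct es3"
    "\<forall>v \<in> set vs3. v = Orig z \<or> (\<exists>i. v = Inner g b3 i)" "\<forall>d \<in> set es3. \<exists>i. d = (g, b3, i)"
    "set vs3 \<subseteq> sverts ?G" "set es3 \<subseteq> sedges ?G"
    "cycle_sign ?G es3 = path_sign w g b3"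
    using path_chain[OF efg(3) e(3) xyz(3) sub(3) L(3) refl] by blast
  have ne: "vs1 \<noteq> []" "vs2 \<noteq> []" "vs3 \<noteq> []" using 1 2 3 by (auto simp: chain_def)
  have "is_cycle ?G (vs1 @ vs2 @ vs3) (es1 @ es2 @ es3)"
  proof (rule is_cycle_chain)
    show "chain ?G (vs1 @ vs2 @ vs3) (es1 @ es2 @ es3) (hd (vs1 @ vs2 @ vs3))"
      using 1 2 3 ne by (intro chain_append) simp_all
    have "set vs1 \<inter> set vs2 = {}" "set vs1 \<inter> set vs3 = {}" "set vs2 \<inter> set vs3 = {}"
      using disjoint_path_vertices[OF 1(6) 2(6) xyz(1)] disjoint_path_vertices[OF 1(6) 3(6)]
        disjoint_path_vertices[OF 2(6) 3(6) xyz(2)] xyz(3) efg(4-6) by auto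
    then show "distinct (vs1 @ vs2 @ vs3)" using 1(4) 2(4) 3(4) by auto
    have "set es1 \<inter> set es2 = {}" "set es1 \<inter> set es3 = {}" "set es2 \<inter> set es3 = {}"
      using disjoint_path_edges[OF 1(7) 2(7)] disjoint_path_edges[OF 1(7) 3(7)]
        disjoint_path_edges[OF 2(7) 3(7)] efg(4-6) by auto
    then show "distinct (es1 @ es2 @ es3)" using 1(5) 2(5) 3(5) by auto
    show "set (vs1 @ vs2 @ vs3) \<subseteq> sverts ?G" using 1(8) 2(8) 3(8) by simp
    show "set (es1 @ es2 @ es3) \<subseteq> sedges ?G" using 1(9) 2(9) 3(9) by simp
  qed
  moreover have "cycle_sign ?G (es1 @ es2 @ es3) = -1"
    using 1(10) 2(10) 3(10) s by (simp add: cycle_sign_def mult.assoc)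
  ultimately show ?thesis
    using that[of "vs1 @ vs2 @ vs3" "es1 @ es2 @ es3"] 1(3) 2(3) 3(3)
    by (simp add: is_negative_cycle_def)
qed

section \<open>Wideness\<close>

lemma unbalanced_girth_ge_iff:
  "enat n \<le> unbalanced_girth G \<longleftrightarrow> (\<forall>vs es. is_negative_cycle G vs es \<longrightarrow> n \<le> length es)"
proof -
  have "enat n \<le> unbalanced_girth G \<longleftrightarrow>
    (\<forall>vs es. is_negative_cycle G vs es \<longrightarrow> enat n \<le> enat (length es))"
    unfolding unbalanced_girth_def le_Inf_iff by blast
  then show ?thesis by simp
qed

text \<open>Any edge yields a negative cycle of length \<open>2 * k\<close>, so only the lower bound
  on the girth is left to check. The guard \<open>edges H \<noteq> {}\<close> reflects the
  convention for edgeless graphs.\<close>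

lemma two_k_wide_iff:
  assumes "0 < k" "simple_graph H" "\<forall>e \<in> edges H. 1 \<le> \<bar>w e\<bar> \<and> \<bar>w e\<bar> \<le> int k"
  shows "two_k_wide k H w \<longleftrightarrow>
    (\<forall>vs es. edges H \<noteq> {} \<longrightarrow> is_negative_cycle (double_path_graph k H w) vs es \<longrightarrow> 2 * k \<le> length es)"
proof (cases "edges H = {}")
  case False
  then obtain e where e: "e \<in> edges H" by blast
  then obtain vs es where c: "is_negative_cycle (double_path_graph k H w) vs es" "length es = 2 * k"
    using edge_negative_cycle[of e H w k] assms by (auto simp: simple_graph_def)
  then have "unbalanced_girth (double_path_graph k H w) \<le> enat (2 * k)"
    unfolding unbalanced_girth_def by (intro Inf_lower) force
  then have "two_k_wide k H w \<longleftrightarrow> enat (2 * k) \<le> unbalanced_girth (double_path_graph k H w)"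
    using False by (auto simp: two_k_wide_def)
  with False show ?thesis by (simp add: unbalanced_girth_ge_iff)
qed (simp add: two_k_wide_def)

text \<open>Ends and signs in the subdivision depend on \<open>k\<close>, \<open>w\<close> and the
  edge but not on the ambient graph, so every negative cycle over \<open>T\<close> is one over
  \<open>H\<close>.\<close>

lemma two_k_wide_subgraph:
  assumes "0 < k" "simple_graph H" "\<forall>e \<in> edges H. 1 \<le> \<bar>w e\<bar> \<and> \<bar>w e\<bar> \<le> int k"
    and T: "subgraph T H" and "two_k_wide k H w"
  shows "two_k_wide k T w"
proof -
  have w: "\<forall>e \<in> edges T. 1 \<le> \<bar>w e\<bar> \<and> \<bar>w e\<bar> \<le> int k" and sT: "simple_graph T"
    using T assms(3) by (auto simp: subgraph_def)
  have "is_negative_cycle (double_path_graph k H w) vs es"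
    if "is_negative_cycle (double_path_graph k T w) vs es" for vs es
  proof -
    let ?GT = "double_path_graph k T w" and ?GH = "double_path_graph k H w"
    have "sverts ?GT \<subseteq> sverts ?GH" "sedges ?GT \<subseteq> sedges ?GH"
      "ends ?GT = ends ?GH" "sign ?GT = sign ?GH"
      using T by (auto simp: double_path_graph_def subgraph_def)
    with that show ?thesis
      by (auto simp: is_negative_cycle_def is_cycle_def cycle_sign_def)
  qed
  then show ?thesis
    using assms(5) T unfolding two_k_wide_iff[OF assms(1-3)] two_k_wide_iff[OF assms(1) sT w]
    by (fastforce simp: subgraph_def)
qed

text \<open>For a negative weight the path of length \<open>\<bar>w e\<bar>\<close> is the negative
  one, so the positive one has length \<open>2k - \<bar>w e\<bar>\<close>, that is
  \<open>2k + w e\<close>.\<close>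

definition positive_length :: "nat \<Rightarrow> ('v set \<Rightarrow> int) \<Rightarrow> 'v set \<Rightarrow> int" where
  "positive_length k w e = (if 0 < w e then w e else 2 * int k + w e)"

lemma path_length_sign:
  assumes "1 \<le> \<bar>w e\<bar>" "\<bar>w e\<bar> \<le> int k"
  shows "path_sign w e b = 1 \<and> int (path_length k w e b) = positive_length k w e \<or>
     path_sign w e b = -1 \<and> int (path_length k w e b) = 2 * int k - positive_length k w e"
  using assms by (auto simp: path_sign_def path_length_def positive_length_def)

text \<open>With \<open>p\<close> the positive length, the length is \<open>p\<close> for
  \<open>s = 1\<close> and \<open>2k - p\<close> for \<open>s = -1\<close>. The form linear in
  \<open>s\<close> allows all sign patterns on a triangle to be treated at once.\<close>

lemma path_of_sign:
  assumes "1 \<le> \<bar>w e\<bar>" "\<bar>w e\<bar> \<le> int k" "s = 1 \<or> s = -1"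
  obtains b where "path_sign w e b = s" "0 < path_length k w e b"
    "int (path_length k w e b) = k - s * (k - positive_length k w e)"
\<comment> \<open>Path \<open>True\<close> has the sign of \<open>w e\<close>, so it is taken
  exactly when that sign is \<open>s\<close>.\<close>
proof (rule that[of "(0 < w e) = (s = 1)"])
qed (use assms in \<open>auto simp: path_sign_def path_length_def positive_length_def\<close>)

lemma positive_length_bounds:
  assumes "1 \<le> \<bar>w e\<bar>" "\<bar>w e\<bar> \<le> int k"
  shows "0 < positive_length k w e" "positive_length k w e < 2 * int k"
  using assms by (auto simp: positive_length_def)

text \<open>Each choice of one path per side with sign product -1 gives a negative cycle, which
  wideness forces to have length at least \<open>2k\<close>.\<close>

lemma triangle_inequalities:
  assumes xyz: "x \<noteq> y" "y \<noteq> z" "z \<noteq> x"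
    and T: "verts T = {x, y, z}" "edges T = {e. e \<subseteq> verts T \<and> card e = 2}"
    and w: "\<forall>e \<in> edges T. 1 \<le> \<bar>w e\<bar> \<and> \<bar>w e\<bar> \<le> int k" and k: "0 < k"
    and wide: "two_k_wide k T w"
  defines "p \<equiv> positive_length k w"
  shows "p {x, y} \<le> p {y, z} + p {z, x}" "p {y, z} \<le> p {x, y} + p {z, x}"
    "p {z, x} \<le> p {x, y} + p {y, z}" "p {x, y} + p {y, z} + p {z, x} \<le> 4 * int k"
proof -
  have sT: "simple_graph T" using T by (auto simp: simple_graph_def)
  have E: "{{x, y}, {y, z}, {z, x}} \<subseteq> edges T" using T xyz by auto
  then have E': "edges T \<noteq> {}" by auto
  have key: "3 * k - s1 * (k - p {x, y}) - s2 * (k - p {y, z}) - s3 * (k - p {z, x}) \<ge> 2 * int k"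
    if s: "s1 = 1 \<or> s1 = -1" "s2 = 1 \<or> s2 = -1" "s3 = 1 \<or> s3 = -1" "s1 * s2 * s3 = (-1::int)"
    for s1 s2 s3
  proof -
    obtain b1 where b1: "path_sign w {x, y} b1 = s1" "0 < path_length k w {x, y} b1"
      "int (path_length k w {x, y} b1) = k - s1 * (k - p {x, y})"
      using path_of_sign[of w "{x, y}" k s1] E w s(1) unfolding p_def by auto
    obtain b2 where b2: "path_sign w {y, z} b2 = s2" "0 < path_length k w {y, z} b2"
      "int (path_length k w {y, z} b2) = k - s2 * (k - p {y, z})"
      using path_of_sign[of w "{y, z}" k s2] E w s(2) unfolding p_def by auto
    obtain b3 where b3: "path_sign w {z, x} b3 = s3" "0 < path_length k w {z, x} b3"
      "int (path_length k w {z, x} b3) = k - s3 * (k - p {z, x})"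
      using path_of_sign[of w "{z, x}" k s3] E w s(3) unfolding p_def by auto
    obtain vs es where c: "is_negative_cycle (double_path_graph k T w) vs es"
      "length es = path_length k w {x, y} b1 + path_length k w {y, z} b2 + path_length k w {z, x} b3"
      by (rule triangle_negative_cycle[OF xyz _ refl refl refl E b1(2) b2(2) b3(2)])
        (use T b1 b2 b3 s in auto)
    have "2 * k \<le> length es"
      using wide c(1) E' unfolding two_k_wide_iff[OF k sT w] by blast
    then show ?thesis using c(2) b1(3) b2(3) b3(3) by linarith
  qed
  \<comment> \<open>One negative side turns the bound into a triangle inequality; three negative
    sides turn it into \<open>6k - perimeter \<ge> 2k\<close>.\<close>
  from key[of "-1" 1 1] key[of 1 "-1" 1] key[of 1 1 "-1"] key[of "-1" "-1" "-1"]
  show "p {x, y} \<le> p {y, z} + p {z, x}" "p {y, z} \<le> p {x, y} + p {z, x}"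
    "p {z, x} \<le> p {x, y} + p {y, z}" "p {x, y} + p {y, z} + p {z, x} \<le> 4 * int k"
    by simp_all
qed

section \<open>Potentials on the subdivision\<close>

lemma path_sign_abs: "w e \<noteq> 0 \<Longrightarrow> \<bar>path_sign w e b\<bar> = 1"
  by (auto simp: path_sign_def)

text \<open>Along each replacing path the value moves by unit steps from \<open>h (tail e)\<close>
  towards \<open>path_sign w e b * h (head e)\<close> and rests once it is reached. The hypothesis
  on \<open>h\<close> says that the path is long enough for this.\<close>

lemma potential_extension:
  fixes h :: "'v \<Rightarrow> int"
  assumes w: "edge_weighting H w"
    and h: "\<And>e b. e \<in> edges H \<Longrightarrow>
      \<bar>h (tail e) - path_sign w e b * h (head e)\<bar> \<le> int (path_length k w e b)"
  obtains F :: "'v dvertex \<Rightarrow> int" where "\<And>v. F (Orig v) = h v"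
    and "\<And>d u v. d \<in> sedges (double_path_graph k H w) \<Longrightarrow> ends (double_path_graph k H w) d = {u, v} \<Longrightarrow>
      \<bar>F u - sign (double_path_graph k H w) d * F v\<bar> \<le> 1"
proof -
  let ?G = "double_path_graph k H w"
  \<comment> \<open>The target value is clamped to the interval of radius \<open>i\<close> around
    \<open>h (tail e)\<close>.\<close>
  define g where "g e b i = max (h (tail e) - int i)
    (min (h (tail e) + int i) (path_sign w e b * h (head e)))" for e b i
  \<comment> \<open>The sign of a path sits on its edge 0, so all values beyond that edge are
    multiplied by it.\<close>
  define F where "F u = (case u of Orig v \<Rightarrow> h v | Inner e b i \<Rightarrow> path_sign w e b * g e b i)" for u
  have bound: "\<bar>F u - sign ?G d * F v\<bar> \<le> 1"
    if d: "d \<in> sedges ?G" and uv: "ends ?G d = {u, v}" for d u v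
  proof -
    obtain e b i where e: "d = (e, b, i)" "e \<in> edges H" "i < path_length k w e b"
      using d by (auto simp: double_path_graph_def)
    let ?s = "path_sign w e b" and ?P = "path_vertex k w e b"
    have s: "?s = 1 \<or> ?s = -1"
      using path_sign_abs[of w e b] e(2) w by (auto simp: edge_weighting_def)
    have g0: "g e b 0 = h (tail e)" by (auto simp: g_def)
    have gL: "g e b (path_length k w e b) = ?s * h (head e)"
      using h[OF e(2), of b] by (auto simp: g_def)
    have step: "\<bar>g e b i - g e b (Suc i)\<bar> \<le> 1" by (auto simp: g_def)
    \<comment> \<open>There is no sign factor at \<open>j = 0\<close>, which lies before the signed
      edge; at the far end the sign squares to 1 and leaves \<open>h (head e)\<close>.\<close>
    have FP: "F (?P j) = (if j = 0 then g e b 0 else ?s * g e b j)" if "j \<le> path_length k w e b" for j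
      using that s g0 gL by (auto simp: path_vertex_def F_def)
    have sd: "sign ?G d = (if i = 0 then ?s else 1)"
      by (simp add: e double_path_graph_def)
    have "\<bar>F (?P i) - sign ?G d * F (?P (Suc i))\<bar> \<le> 1"
      using step s e(3) by (auto simp: FP sd)
    \<comment> \<open>\<open>ends\<close> is an unordered pair, so the inequality is needed in both
      orders.\<close>
    moreover from this s have "\<bar>F (?P (Suc i)) - sign ?G d * F (?P i)\<bar> \<le> 1"
      by (auto simp: sd split: if_splits)
    moreover have "{u, v} = {?P i, ?P (Suc i)}" using uv by (simp add: e double_path_graph_def)
    ultimately show ?thesis by (auto simp: doubleton_eq_iff)
  qed
  show ?thesis by (rule that[of F]) (simp_all add: F_def bound[unfolded F_def])
qed

text \<open>A product different from 1 has a factor different from 1. Only the edge 0 of a path can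
  be such a factor, and it starts at the tail. This provides an original vertex of the cycle at
  which to root the potential.\<close>

lemma negative_cycle_meets_Orig:
  assumes "is_negative_cycle (double_path_graph k H w) vs es"
  obtains e where "e \<in> edges H" "Orig (tail e) \<in> set vs"
proof -
  let ?G = "double_path_graph k H w"
  have "\<exists>d \<in> set es. sign ?G d \<noteq> 1"
  proof (rule ccontr)
    assume "\<not> ?thesis"
    then have "map (sign ?G) es = map (\<lambda>_. 1) es" by auto
    then have "cycle_sign ?G es = 1" by (simp add: cycle_sign_def map_replicate_const)
    with assms show False by (simp add: is_negative_cycle_def)
  qed
  then obtain j where j: "j < length es" "sign ?G (es ! j) \<noteq> 1" by (auto simp: in_set_conv_nth)
  have c: "is_cycle ?G vs es" using assms by (simp add: is_negative_cycle_def)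
  then have "es ! j \<in> sedges ?G" using j by (auto simp: is_cycle_def)
  then obtain e b where e: "e \<in> edges H" "es ! j = (e, b, 0)"
    using j(2) by (auto simp: double_path_graph_def split: if_splits)
  then have "Orig (tail e) \<in> ends ?G (es ! j)"
    by (simp add: double_path_graph_def path_vertex_def)
  then have "Orig (tail e) \<in> {vs ! j, vs ! (Suc j mod length vs)}"
    using c j(1) by (simp add: is_cycle_def)
  moreover have "j < length vs" "Suc j mod length vs < length vs"
    using c j(1) by (auto simp: is_cycle_def)
  ultimately have "Orig (tail e) \<in> set vs" by (auto simp del: mod_less_divisor)
  with e show ?thesis using that by blast
qed

section \<open>From triangles to the complete graph\<close>

theorem theorem2:
  fixes k t :: nat and H :: "'v sgraph" and w :: "'v set \<Rightarrow> int"
  assumes "0 < k" and "0 < t"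
    and "complete_graph t H"
    and "edge_weighting H w"
    and "bipartite_weighting H w"
    and "\<forall>e \<in> edges H. 1 \<le> \<bar>w e\<bar> \<and> \<bar>w e\<bar> \<le> int k"
  shows "two_k_wide k H w \<longleftrightarrow> (\<forall>T. triangle_of T H \<longrightarrow> two_k_wide k T w)"
proof
  have sH: "simple_graph H" and EH: "edges H = {e. e \<subseteq> verts H \<and> card e = 2}"
    using assms(3) by (auto simp: complete_graph_def simple_graph_def)
  note w = assms(6)
  {
    assume "two_k_wide k H w"
    then show "\<forall>T. triangle_of T H \<longrightarrow> two_k_wide k T w"
      using two_k_wide_subgraph[OF assms(1) sH w] by (auto simp: triangle_of_def)
  }
  assume wide: "\<forall>T. triangle_of T H \<longrightarrow> two_k_wide k T w"
  define p where "p = positive_length k w"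
  have tri: "p {x, y} \<le> p {y, z} + p {z, x} \<and> p {y, z} \<le> p {x, y} + p {z, x} \<and>
      p {z, x} \<le> p {x, y} + p {y, z} \<and> p {x, y} + p {y, z} + p {z, x} \<le> 4 * int k"
    if "x \<noteq> y" "y \<noteq> z" "z \<noteq> x" "{x, y, z} \<subseteq> verts H" for x y z
  proof -
    define T where "T = \<lparr>verts = {x, y, z}, edges = {e. e \<subseteq> {x, y, z} \<and> card e = 2}\<rparr>"
    have "triangle_of T H"
      using that
      by (auto simp: triangle_of_def subgraph_def simple_graph_def complete_graph_def T_def EH)
    moreover from this have "\<forall>e \<in> edges T. 1 \<le> \<bar>w e\<bar> \<and> \<bar>w e\<bar> \<le> int k"
      using w by (auto simp: triangle_of_def subgraph_def)
    ultimately show ?thesis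
      unfolding p_def using wide that(1-3) assms(1)
      by (intro conjI triangle_inequalities[of x y z T w k]) (simp_all add: T_def)
  qed
  have "2 * k \<le> length es" if cyc: "is_negative_cycle (double_path_graph k H w) vs es" for vs es
  proof -
    let ?G = "double_path_graph k H w"
    obtain e0 where e0: "e0 \<in> edges H" "Orig (tail e0) \<in> set vs"
      by (rule negative_cycle_meets_Orig[OF cyc])
    \<comment> \<open>The root lies on the given cycle, so the potential is chosen separately for
      each cycle.\<close>
    define x where "x = tail e0"
    have "x \<in> e0" using e0(1) EH edge_tail_head(1)[of e0] unfolding x_def by auto
    then have x: "x \<in> verts H" using e0 EH by auto
    \<comment> \<open>The value at \<open>x\<close> corresponds to length 0 from \<open>x\<close> to
      itself; it needs its own case because \<open>{x, x}\<close> is not an edge.\<close>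
    define h where "h y = (if y = x then int k else int k - p {x, y})" for y
    have h: "\<bar>h (tail e) - path_sign w e b * h (head e)\<bar> \<le> int (path_length k w e b)"
      if e: "e \<in> edges H" for e b
    proof -
      define a c where "a = tail e" and "c = head e"
      have "e = {a, c}" "a \<noteq> c"
        using e EH edge_tail_head[of e] unfolding a_def c_def by auto
      then have ac: "e = {a, c}" "a \<noteq> c" "a \<in> verts H" "c \<in> verts H" using e EH by auto
      have pb: "0 < p e" "p e < 2 * int k"
        using positive_length_bounds[of w e k] w e unfolding p_def by auto
      \<comment> \<open>The first inequality serves the positive path, the second the negative
        one.\<close>
      have "\<bar>h a - h c\<bar> \<le> p e \<and> \<bar>h a + h c\<bar> \<le> 2 * int k - p e"
      proof (cases "a = x \<or> c = x")
        case True
        \<comment> \<open>One of the two values is \<open>k\<close> and the other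
          \<open>k - p e\<close>, so both bounds are attained.\<close>
        then show ?thesis using pb ac by (auto simp: h_def insert_commute)
      next
        case False
        \<comment> \<open>Two triangle inequalities bound the difference. The sum is
          \<open>2k - p {x, a} - p {x, c}\<close>; the third triangle inequality bounds it from
          above and the perimeter condition from below.\<close>
        then show ?thesis
          using tri[of x a c] ac x by (auto simp: h_def insert_commute)
      qed
      then show ?thesis
        using path_length_sign[of w e k b] w e unfolding a_def c_def p_def by auto
    qed
    obtain F where F: "\<And>v. F (Orig v) = h v"
      "\<And>d u v. d \<in> sedges ?G \<Longrightarrow> ends ?G d = {u, v} \<Longrightarrow> \<bar>F u - sign ?G d * F v\<bar> \<le> 1"
      using potential_extension[OF assms(4) h] by blast
    have "2 * \<bar>F (Orig (tail e0))\<bar> \<le> int (length es)"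
    proof (rule negative_cycle_length_ge[OF cyc])
      show "\<bar>sign ?G d\<bar> = 1" if "d \<in> sedges ?G" for d
        using that assms(4) by (auto simp: double_path_graph_def path_sign_abs edge_weighting_def)
    qed (fact F(2) e0(2))+
    then show ?thesis by (simp add: F(1) h_def x_def)
  qed
  then show "two_k_wide k H w" unfolding two_k_wide_iff[OF assms(1) sH w] by blast
qed

end
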